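(* Let $$\mathcal{A}=\Big\{(a,b,c)\in\tfrac12\mathbb{Z}\times\tfrac12\mathbb{Z}\times\mathbb{Z} : a+b\in\mathbb{Z}\Big\}.$$ A triple $(a,b,c)$ is equal to $\big(A(\mathcal{P}),\frac12B(\mathcal{P}),C(\mathcal{P})\big)$ for some lattice multi-polygon $\mathcal{P}$ if and only if $(a,b,c)\in\mathcal{A}$.
   Context: A lattice multi-polygon is a sequence $\mathcal{P}=(v_1,\dots,v_d)$ of points of $\mathbb{Z}^2$, with $v_i\ne v_{i+1}$ for all $i$ (indices cyclic modulo $d$, $v_{d+1}=v_1$), regarded as an oriented closed piecewise linear loop obtained by joining $v_i$ to $v_{i+1}$ by a straight segment (the side $v_iv_{i+1}$), together with a sign $\epsilon(v_iv_{i+1})\in\{+1,-1\}$ for each side, such that whenever three consecutive points $v_{i-1},v_i,v_{i+1}$ lie on a line: (1) $\epsilon(v_{i-1}v_i)=\epsilon(v_iv_{i+1})$ if $v_i$ is in between $v_{i-1}$ and $v_{i+1}$; (2) $\epsilon(v_{i-1}v_i)\ne\epsilon(v_iv_{i+1})$ if $v_{i-1}$ lies on the segment $v_iv_{i+1}$ or $v_{i+1}$ lies on the segment $v_{i-1}v_i$. The loop may have self-intersections. For each $i$, $n_i$ denotes a normal vector to the side $v_iv_{i+1}$ such that the 90 degree (counterclockwise) rotation of $\epsilon(v_iv_{i+1})n_i$ has the same direction as the vector from $v_i$ to $v_{i+1}$. Because of (1) and (2), $n_i$ and $n_{i+1}$ never point in opposite directions. For $v\in\mathbb{R}^2$ not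 on any side of $\mathcal{P}$, $d_{\mathcal{P}}(v)$ is the winding number of the oriented loop $\mathcal{P}$ around $v$ (counterclockwise positive). Define: - $A(\mathcal{P})=\int_{\mathbb{R}^2\setminus\mathcal{P}}d_{\mathcal{P}}(v)\,dv$, where $\mathbb{R}^2\setminus\mathcal{P}$ is the set of points lying on no side of $\mathcal{P}$. - $B(\mathcal{P})=\sum_{i=1}^d\epsilon(v_iv_{i+1})\,|v_iv_{i+1}|$, where $|v_iv_{i+1}|$ is the number of lattice points on the segment $v_iv_{i+1}$ minus $1$. - $C(\mathcal{P})$ is the rotation number of the sequence $n_1,\dots,n_d$ around the origin, that is, $\frac1{2\pi}\sum_{i=1}^d\theta_i$, where $\theta_i\in(-\pi,\pi)$ is the signed angle (counterclockwise positive) from $n_i$ to $n_{i+1}$, with $n_{d+1}=n_1$. *)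

theory Defs
  imports "HOL-Complex_Analysis.Complex_Analysis"
begin

text \<open>
  The plane \<open>\<real>\<^sup>2\<close> is identified with \<^typ>\<open>complex\<close>, so that the library's winding number and
  Lebesgue measure apply; the lattice is \<^typ>\<open>int \<times> int\<close>, embedded by \<open>pt\<close>.
  A multi-polygon is given by its list \<open>vs\<close> of vertices and the list \<open>es\<close> of signs, where
  \<open>es ! i\<close> is the sign of the side from vertex \<open>i\<close> to vertex \<open>i + 1\<close>; indices start at \<open>0\<close> and are
  read cyclically.
\<close>

definition pt :: "int \<times> int \<Rightarrow> complex" where
  "pt p = Complex (of_int (fst p)) (of_int (snd p))"

definition cyc :: "'a list \<Rightarrow> nat \<Rightarrow> 'a" where
  "cyc xs i = xs ! (i mod length xs)"

abbreviation vertex :: "(int \<times> int) list \<Rightarrow> nat \<Rightarrow> complex" where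
  "vertex vs i \<equiv> pt (cyc vs i)"

definition side :: "(int \<times> int) list \<Rightarrow> nat \<Rightarrow> complex set" where
  "side vs i = closed_segment (vertex vs i) (vertex vs (i + 1))"

text \<open>
  In conditions (1) and (2) the triple of consecutive points is \<open>v\<^sub>i, v\<^sub>i\<^sub>+\<^sub>1, v\<^sub>i\<^sub>+\<^sub>2\<close>. As consecutive
  points are distinct, it makes no difference whether the segments are taken closed.
\<close>

definition lattice_multi_polygon :: "(int \<times> int) list \<Rightarrow> int list \<Rightarrow> bool" where
  "lattice_multi_polygon vs es \<longleftrightarrow>
     vs \<noteq> [] \<and> length es = length vs \<and> set es \<subseteq> {1, -1} \<and>
     (\<forall>i < length vs. cyc vs i \<noteq> cyc vs (i + 1)) \<and>
     (\<forall>i < length vs.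
        collinear {vertex vs i, vertex vs (i + 1), vertex vs (i + 2)} \<longrightarrow>
          (vertex vs (i + 1) \<in> closed_segment (vertex vs i) (vertex vs (i + 2)) \<longrightarrow>
             cyc es i = cyc es (i + 1)) \<and>
          (vertex vs i \<in> closed_segment (vertex vs (i + 1)) (vertex vs (i + 2)) \<or>
           vertex vs (i + 2) \<in> closed_segment (vertex vs i) (vertex vs (i + 1)) \<longrightarrow>
             cyc es i \<noteq> cyc es (i + 1)))"

fun polyline :: "complex list \<Rightarrow> real \<Rightarrow> complex" where
  "polyline [] = linepath 0 0"
| "polyline [a] = linepath a a"
| "polyline [a, b] = linepath a b"
| "polyline (a # b # c # zs) = linepath a b +++ polyline (b # c # zs)"

definition loop :: "(int \<times> int) list \<Rightarrow> real \<Rightarrow> complex" where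
  "loop vs = polyline (map pt (vs @ [hd vs]))"

text \<open>
  \<^const>\<open>winding_number\<close> is complex-valued; off the sides of the closed loop its value is an integer.
\<close>

definition mp_A :: "(int \<times> int) list \<Rightarrow> real" where
  "mp_A vs = (LINT z : - (\<Union>i < length vs. side vs i) | lborel. Re (winding_number (loop vs) z))"

definition side_length :: "(int \<times> int) list \<Rightarrow> nat \<Rightarrow> int" where
  "side_length vs i = int (card {p. pt p \<in> side vs i}) - 1"

definition mp_B :: "(int \<times> int) list \<Rightarrow> int list \<Rightarrow> int" where
  "mp_B vs es = (\<Sum>i < length vs. cyc es i * side_length vs i)"

text \<open>
  The normal vector of the \<open>i\<close>-th side is normalised to have the length of that side: rotating
  \<open>\<epsilon> n\<close> counterclockwise by \<open>90\<close> degrees, i.e. multiplying it by \<^term>\<open>\<i>\<close>, gives exactly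
  \<open>v\<^sub>i\<^sub>+\<^sub>1 - v\<^sub>i\<close>. Only the direction matters for the rotation number.
\<close>

definition side_normal :: "(int \<times> int) list \<Rightarrow> int list \<Rightarrow> nat \<Rightarrow> complex" where
  "side_normal vs es i = - \<i> * of_int (cyc es i) * (vertex vs (i + 1) - vertex vs i)"

lemma rotated_normal:
  assumes "cyc es i \<in> {1, -1}"
  shows "\<i> * (of_int (cyc es i) * side_normal vs es i) = vertex vs (i + 1) - vertex vs i"
  using assms by (auto simp: side_normal_def)

text \<open>
  The signed angle from \<open>n\<close> to \<open>n'\<close> is \<open>Arg (n' / n)\<close>. Its range is \<open>(-\<pi>, \<pi>]\<close>, but consecutive
  normals of a lattice multi-polygon never point in opposite directions, so \<open>\<pi>\<close> does not occur.
\<close>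

definition mp_C :: "(int \<times> int) list \<Rightarrow> int list \<Rightarrow> real" where
  "mp_C vs es = (\<Sum>i < length vs. Arg (side_normal vs es (i + 1) / side_normal vs es i)) / (2 * pi)"

definition half_ints :: "real set" where
  "half_ints = {x. \<exists>k::int. x = of_int k / 2}"

definition triples :: "(real \<times> real \<times> real) set" where
  "triples = {(a, b, c). a \<in> half_ints \<and> b \<in> half_ints \<and> c \<in> \<int> \<and> a + b \<in> \<int>}"

end

theory Submission
  imports Defs
begin

text \<open>
  The area \<open>A\<close> is given by the shoelace formula: the winding number of the loop is almost everywhere
  the sum of the winding numbers of the oriented triangles spanned by the origin and a side
  (\<open>winding_number_triangle_at_0\<close>, \<open>mp_A_eq_shoelace\<close>). So \<open>2 A\<close> is the integer
  \<open>\<Sum>i. x\<^sub>i y\<^sub>i\<^sub>+\<^sub>1 - y\<^sub>i x\<^sub>i\<^sub>+\<^sub>1\<close>. A side with direction \<open>(x, y)\<close> has length \<open>gcd x y\<close>, which is congruent to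
  \<open>x + y + x y\<close> modulo 2; summing around the loop gives \<open>B \<equiv> 2 A\<close> modulo 2
  (\<open>mp_B_shoelace_parity\<close>). The rotation number is an integer because the turns of a closed cyclic
  sequence of vectors add up to full turns (\<open>mp_C_in_Ints\<close>). This is the "only if" direction.

  For the converse, let two multi-polygons have the same first side with the same sign. Running
  through one and then through the other gives a multi-polygon again, and \<open>A\<close>, \<open>B\<close> and \<open>C\<close> add
  up, because they are sums of terms depending on a few consecutive vertices and signs
  (\<open>append_common_first_side\<close>). So the triples \<open>(2 A, B, C)\<close> that occur with the first side
  \<open>(0, 0)(1, 0)\<close> of sign \<open>1\<close> form a semigroup. Six small multi-polygons suffice to generate all
  triples with \<open>2 A \<equiv> B\<close> modulo 2 (\<open>anchored_all\<close>): the triangles \<open>\<plusminus>(1, 0, 1) + (0, 3, 0)\<close>, and the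
  zigzags of area zero, which realise \<open>(0, \<plusminus>2, 0)\<close> and \<open>\<plusminus>(0, 2, 1)\<close>.
\<close>

section \<open>Cyclic lists\<close>

lemma cyc_add_length: "cyc xs (length xs + i) = cyc xs i"
  by (simp add: cyc_def)

lemma sum_cyc_shift:
  fixes f :: "'a \<Rightarrow> 'b :: ab_group_add"
  assumes "vs \<noteq> []"
  shows "(\<Sum>i < length vs. f (cyc vs (i + 1))) = (\<Sum>i < length vs. f (cyc vs i))"
proof -
  have "(\<Sum>i < length vs. f (cyc vs (Suc i))) + f (cyc vs 0)
      = (\<Sum>i < Suc (length vs). f (cyc vs i))"
    by (simp add: sum.lessThan_Suc_shift add.commute del: sum.lessThan_Suc)
  then show ?thesis by (simp add: cyc_def)
qed

text \<open>
  If two lists agree on their first \<open>r\<close> entries, then in their concatenation every window of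
  \<open>r + 1\<close> cyclically consecutive entries is already such a window of one of the two lists: a window
  that runs over the end of either list meets the common initial entries, as it does in the list
  itself. Hence every cyclic sum of a quantity that depends only on such windows is additive.
\<close>

lemma cyc_append:
  assumes "take r xs = take r ys" "r \<le> length xs" "r \<le> length ys" "k \<le> r"
  shows "i < length xs \<Longrightarrow> cyc (xs @ ys) (i + k) = cyc xs (i + k)"
    and "j < length ys \<Longrightarrow> cyc (xs @ ys) (length xs + j + k) = cyc ys (j + k)"
proof -
  have eq: "xs ! l = ys ! l" if "l < r" for l
    using that assms(1) by (metis nth_take)
  show "cyc (xs @ ys) (i + k) = cyc xs (i + k)" if "i < length xs"
  proof (cases "i + k < length xs")
    case False
    define l where "l = i + k - length xs"
    have "i + k = length xs + l" "l < r" using False that assms by (auto simp: l_def)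
    then show ?thesis using assms eq[of l] by (simp add: cyc_def nth_append)
  qed (simp add: cyc_def nth_append)
  show "cyc (xs @ ys) (length xs + j + k) = cyc ys (j + k)" if "j < length ys"
  proof (cases "j + k < length ys")
    case False
    define l where "l = j + k - length ys"
    have l: "j + k = length ys + l" "l < r" using False that assms by (auto simp: l_def)
    then have "cyc (xs @ ys) (length xs + j + k) = cyc (xs @ ys) l"
      using cyc_add_length[of "xs @ ys" l] by (simp add: add.assoc)
    then show ?thesis using assms l eq[of l] cyc_add_length[of ys l]
      by (simp add: cyc_def nth_append)
  qed (simp add: cyc_def nth_append)
qed

lemma sum_lessThan_add:
  fixes f :: "nat \<Rightarrow> 'a :: comm_monoid_add"
  shows "(\<Sum>i < m + n. f i) = (\<Sum>i < m. f i) + (\<Sum>j < n. f (m + j))"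
  by (induction n) (simp_all add: add.assoc)

lemma all_less_add: "(\<forall>i < m + n. P i) \<longleftrightarrow> (\<forall>i < m. P i) \<and> (\<forall>j < n. P (m + j))"
  for m n :: nat
proof (safe)
  fix i assume *: "\<forall>i < m. P i" "\<forall>j < n. P (m + j)" "i < m + n"
  show "P i"
  proof (cases "i < m")
    case False
    then have "P (m + (i - m))" using * by (intro *(2)[rule_format]) simp
    then show ?thesis using False by simp
  qed (use * in blast)
qed auto

section \<open>The area of a triangle\<close>

text \<open>
  The area of a triangle is known for the plane \<open>real ^ 2\<close>. The coordinate map to the complex
  plane preserves Lebesgue measure because it maps boxes to boxes of the same size.
\<close>

definition complex_of_vec :: "real ^ 2 \<Rightarrow> complex" where
  "complex_of_vec x = Complex (x $ 1) (x $ 2)"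

lemma linear_complex_of_vec: "linear complex_of_vec"
  by (rule linearI) (auto simp: complex_of_vec_def complex_eq_iff)

lemma measurable_complex_of_vec: "complex_of_vec \<in> borel_measurable borel"
  by (intro borel_measurable_continuous_onI linear_continuous_on
      linear_conv_bounded_linear[THEN iffD1] linear_complex_of_vec)

lemma distr_complex_of_vec: "distr lborel borel complex_of_vec = lborel"
proof (rule lborel_eqI [symmetric])
  fix l u :: complex
  assume le: "\<And>b. b \<in> Basis \<Longrightarrow> l \<bullet> b \<le> u \<bullet> b"
  define l' u' :: "real ^ 2" where "l' = vector [Re l, Im l]" and "u' = vector [Re u, Im u]"
  have le': "l' $ i \<le> u' $ i" for i
    using le[of 1] le[of \<i>] exhaust_2[of i]
    by (auto simp: l'_def u'_def Basis_complex_def inner_complex_def)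
  have "complex_of_vec -` box l u = box l' u'"
    by (auto simp: complex_of_vec_def box_def Basis_complex_def inner_complex_def l'_def u'_def
        Basis_vec_def inner_axis forall_2)
  then have "emeasure (distr lborel borel complex_of_vec) (box l u) = emeasure lborel (box l' u')"
    using measurable_complex_of_vec by (subst emeasure_distr) auto
  also have "\<dots> = (\<Prod>b\<in>Basis. (u' - l') \<bullet> b)"
    using le' by (subst emeasure_lborel_box) (auto simp: Basis_vec_def inner_axis)
  also have "(\<Prod>b\<in>Basis. (u' - l') \<bullet> b) = (\<Prod>i\<in>UNIV. (u' - l') $ i)"
    unfolding Basis_vec_def
    by (subst prod.UNION_disjoint) (auto simp: inner_axis axis_eq_axis)
  also have "\<dots> = (\<Prod>b\<in>Basis. (u - l) \<bullet> b)"
    by (simp add: UNIV_2 l'_def u'_def Basis_complex_def inner_complex_def)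
  finally show "emeasure (distr lborel borel complex_of_vec) (box l u)
      = (\<Prod>b\<in>Basis. (u - l) \<bullet> b)" .
qed auto

lemma measure_complex_triangle:
  "measure lborel (convex hull {a, b, c}) = \<bar>Im (cnj (b - a) * (c - a))\<bar> / 2"
proof -
  define v :: "complex \<Rightarrow> real ^ 2" where "v z = vector [Re z, Im z]" for z
  have cv: "complex_of_vec (v z) = z" and vc: "v (complex_of_vec x) = x" for z x
    by (auto simp: v_def complex_of_vec_def vec_eq_iff forall_2)
  have "convex hull {a, b, c} = complex_of_vec ` (convex hull {v a, v b, v c})"
    by (simp add: convex_hull_linear_image[OF linear_complex_of_vec] cv)
  then have pre: "complex_of_vec -` (convex hull {a, b, c}) = convex hull {v a, v b, v c}"
    using vc by (auto simp: image_iff) metis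
  have "convex hull {a, b, c} \<in> sets borel"
    by (intro borel_closed compact_imp_closed finite_imp_compact_convex_hull) auto
  then have "measure (distr lborel borel complex_of_vec) (convex hull {a, b, c})
      = measure lborel (convex hull {v a, v b, v c})"
    using measurable_complex_of_vec pre by (subst measure_distr) auto
  then show ?thesis
    by (simp add: distr_complex_of_vec content_triangle v_def algebra_simps)
qed

lemma triangle_null_sets:
  assumes "Im (cnj (b - a) * (c - a)) = 0"
  shows "convex hull {a, b, c} \<in> null_sets lborel"
proof -
  have c: "compact (convex hull {a, b, c})"
    by (intro finite_imp_compact_convex_hull) auto
  have "emeasure lborel (convex hull {a, b, c}) = 0"
    using measure_complex_triangle[of a b c] assms emeasure_compact_finite[OF c]
    by (simp add: emeasure_eq_ennreal_measure top.not_eq_extremum)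
  then show ?thesis
    using c by (auto intro!: null_setsI borel_closed compact_imp_closed)
qed

lemma segment_null_sets: "closed_segment a b \<in> null_sets (lborel :: complex measure)"
  using triangle_null_sets[of a a b] by (simp add: segment_convex_hull)

text \<open>
  The contribution of one side \<open>ab\<close> to the area, seen from the origin: outside the triangle
  \<open>0ab\<close> the closed path \<open>0ab0\<close> does not wind around \<open>z\<close>, and inside it winds once, in the
  direction given by the orientation of \<open>(a, b)\<close>. If the triangle is degenerate, its points have
  to be excluded, but then it has measure zero.
\<close>

lemma winding_number_triangle_at_0:
  assumes z: "z \<notin> closed_segment 0 a" "z \<notin> closed_segment a b" "z \<notin> closed_segment b 0"
    and d: "Im (cnj a * b) = 0 \<Longrightarrow> z \<notin> convex hull {0, a, b}"
  shows "winding_number (linepath 0 a) z + winding_number (linepath a b) z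
          + winding_number (linepath b 0) z
        = of_real (sgn (Im (cnj a * b)) * indicat_real (convex hull {0, a, b}) z)"
proof -
  have join: "winding_number (linepath 0 a) z + winding_number (linepath a b) z
          + winding_number (linepath b 0) z
        = winding_number (linepath 0 a +++ linepath a b +++ linepath b 0) z"
    using z by (simp add: winding_number_join not_in_path_image_join)
  show ?thesis
  proof (cases "z \<in> convex hull {0, a, b}")
    case False
    have "winding_number (linepath 0 a +++ linepath a b +++ linepath b 0) z = 0"
    proof (rule winding_number_zero_outside)
      show "path_image (linepath 0 a +++ linepath a b +++ linepath b 0) \<subseteq> convex hull {0, a, b}"
        unfolding path_image_join path_image_linepath segment_convex_hull
        by (simp add: path_image_join segment_convex_hull hull_mono)
    qed (use False in auto)
    then show ?thesis using False join by simp
  next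
    case True
    have "z \<in> interior (convex hull {0, a, b})"
      using z True interior_of_triangle[of 0 a b] by auto
    note wn = winding_number_triangle[OF this]
    obtain u s t where st: "u \<ge> 0" "s \<ge> 0" "t \<ge> 0" "u + s + t = 1"
        "z = u *\<^sub>R 0 + s *\<^sub>R a + t *\<^sub>R b"
      using True unfolding convex_hull_3 by blast
    \<comment> \<open>The formula for triangles reads the orientation off from \<open>z\<close>; the coordinate \<open>t\<close> of \<open>z\<close> at \<open>b\<close>
      translates it into the orientation of \<open>(a, b)\<close>.\<close>
    have "t \<noteq> 0"
    proof
      assume "t = 0"
      then have "z \<in> closed_segment 0 a" using st by (auto simp: in_segment intro!: exI[of _ s])
      with z show False by simp
    qed
    with st have "t > 0" by simp
    have "Im ((a - 0) * cnj (a - z)) = t * Im (cnj a * b)"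
      using st by (simp add: algebra_simps)
    then have "0 < Im ((a - 0) * cnj (a - z)) \<longleftrightarrow> 0 < Im (cnj a * b)"
      using \<open>t > 0\<close> by (simp add: zero_less_mult_iff)
    then show ?thesis
      using wn join True d by (auto simp: sgn_if)
  qed
qed

section \<open>The integral of the winding number\<close>

lemma polyline_path:
  assumes "length zs \<ge> 2"
  shows "path (polyline zs)" "pathstart (polyline zs) = hd zs" "pathfinish (polyline zs) = last zs"
    "path_image (polyline zs) = (\<Union>i < length zs - 1. closed_segment (zs ! i) (zs ! Suc i))"
  using assms
proof (induction zs rule: polyline.induct)
  case (4 a b c zs)
  case 1 show ?case using 4 by simp
  case 2 show ?case by simp
  case 3 show ?case using 4 by simp
  case 4
  have "(\<Union>i < length (a # b # c # zs) - 1.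
            closed_segment ((a # b # c # zs) ! i) ((a # b # c # zs) ! Suc i)) =
        closed_segment a b \<union> (\<Union>i < length (b # c # zs) - 1.
            closed_segment ((b # c # zs) ! i) ((b # c # zs) ! Suc i))"
    by (simp add: lessThan_Suc_eq_insert_0 image_image Un_assoc)
  then show ?case using "4.IH"(2,4) by (simp add: path_image_join)
qed (auto simp: lessThan_Suc)

lemma winding_number_polyline:
  assumes "length zs \<ge> 2" "z \<notin> path_image (polyline zs)"
  shows "winding_number (polyline zs) z
         = (\<Sum>i < length zs - 1. winding_number (linepath (zs ! i) (zs ! Suc i)) z)"
  using assms
proof (induction zs rule: polyline.induct)
  case (4 a b c zs)
  let ?l = "b # c # zs"
  have *: "path (polyline ?l)" "pathstart (polyline ?l) = b"
    using polyline_path[of ?l] by simp_all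
  with 4 have z: "z \<notin> closed_segment a b" "z \<notin> path_image (polyline ?l)"
    by (auto simp: path_image_join)
  have "winding_number (polyline (a # ?l)) z
      = winding_number (linepath a b) z + winding_number (polyline ?l) z"
    using z * by (simp add: winding_number_join)
  also have "winding_number (polyline ?l) z
      = (\<Sum>i < length ?l - 1. winding_number (linepath (?l ! i) (?l ! Suc i)) z)"
    using 4 z by simp
  finally show ?case
    by (simp add: sum.lessThan_Suc_shift del: sum.lessThan_Suc)
qed auto

definition cross :: "int \<times> int \<Rightarrow> int \<times> int \<Rightarrow> int" where
  "cross u w = fst u * snd w - snd u * fst w"

definition shoelace :: "(int \<times> int) list \<Rightarrow> int" where
  "shoelace vs = (\<Sum>i < length vs. cross (cyc vs i) (cyc vs (i + 1)))"

lemma loop_path: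
  assumes "vs \<noteq> []"
  shows "path (loop vs)" "pathfinish (loop vs) = pathstart (loop vs)"
    "path_image (loop vs) = (\<Union>i < length vs. side vs i)"
    "z \<notin> path_image (loop vs) \<Longrightarrow> winding_number (loop vs) z
       = (\<Sum>i < length vs. winding_number (linepath (vertex vs i) (vertex vs (i + 1))) z)"
proof -
  let ?zs = "map pt (vs @ [hd vs])"
  have len: "length ?zs \<ge> 2" using assms by (cases vs) auto
  have nth: "?zs ! i = vertex vs i" if "i \<le> length vs" for i
    using that assms
    by (cases "i = length vs") (auto simp: nth_append cyc_def hd_conv_nth simp del: map_append)
  show "path (loop vs)" "pathfinish (loop vs) = pathstart (loop vs)"
    using polyline_path[OF len] assms by (auto simp: loop_def hd_append hd_map)
  show im: "path_image (loop vs) = (\<Union>i < length vs. side vs i)"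
    using polyline_path(4)[OF len] nth by (simp add: loop_def side_def del: map_append)
  show "winding_number (loop vs) z
       = (\<Sum>i < length vs. winding_number (linepath (vertex vs i) (vertex vs (i + 1))) z)"
    if "z \<notin> path_image (loop vs)"
    using winding_number_polyline[OF len, of z] that nth by (simp add: loop_def del: map_append)
qed

text \<open>
  Join the origin to all vertices. Every spoke \<open>0v\<close> is traversed once in each direction, so off
  the finitely many segments the winding number of the loop is the sum of the winding numbers of
  the triangles \<open>0 v\<^sub>i v\<^sub>i\<^sub>+\<^sub>1\<close>. Each of these integrates to the oriented area of its triangle,
  and degenerate triangles may be put into the exceptional null set.
\<close>

theorem mp_A_eq_shoelace:
  assumes "vs \<noteq> []"
  shows "mp_A vs = of_int (shoelace vs) / 2"
proof -
  define p where "p i = vertex vs i" for i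
  define T where "T i = convex hull {0, p i, p (i + 1)}" for i
  define k where "k i = Im (cnj (p i) * p (i + 1))" for i
  define S where "S = path_image (loop vs)"
  define N where "N = (\<Union>i < length vs. closed_segment 0 (p i) \<union> closed_segment (p i) (p (i + 1))
        \<union> closed_segment (p (i + 1)) 0 \<union> (if k i = 0 then T i else {}))"
  have N: "N \<in> null_sets lborel"
    unfolding N_def using segment_null_sets triangle_null_sets[where a = 0]
    by (intro null_sets_UN' null_sets.Un) (auto simp: T_def k_def)
  have wn: "Re (winding_number (loop vs) z) = (\<Sum>i < length vs. sgn (k i) * indicat_real (T i) z)"
    if "z \<notin> S" "z \<notin> N" for z
  proof -
    have z: "z \<notin> closed_segment 0 (p i)" "z \<notin> closed_segment (p i) (p (i + 1))"
      "z \<notin> closed_segment (p (i + 1)) 0" "k i = 0 \<Longrightarrow> z \<notin> T i" if "i < length vs" for i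
      using that \<open>z \<notin> N\<close> by (auto simp: N_def split: if_splits)
    have rev: "winding_number (linepath (p i) 0) z = - winding_number (linepath 0 (p i)) z"
      if "i < length vs" for i
      using z(1)[OF that] winding_number_reversepath[of "linepath 0 (p i)" z] by simp
    have "(\<Sum>i < length vs. winding_number (linepath (p (i + 1)) 0) z)
        = (\<Sum>i < length vs. winding_number (linepath (p i) 0) z)"
      using sum_cyc_shift[OF assms, of "\<lambda>v. winding_number (linepath (pt v) 0) z"] by (simp add: p_def)
    also have "\<dots> = - (\<Sum>i < length vs. winding_number (linepath 0 (p i)) z)"
      by (simp add: rev sum_negf)
    finally have "winding_number (loop vs) z = (\<Sum>i < length vs. winding_number (linepath 0 (p i)) z
          + winding_number (linepath (p i) (p (i + 1))) z + winding_number (linepath (p (i + 1)) 0) z)"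
      using loop_path(4)[OF assms, of z] \<open>z \<notin> S\<close> by (simp add: sum.distrib p_def S_def)
    also have "\<dots> = (\<Sum>i < length vs. of_real (sgn (k i) * indicat_real (T i) z))"
      using z unfolding k_def T_def
      by (intro sum.cong refl winding_number_triangle_at_0) (auto simp: closed_segment_commute)
    finally show ?thesis by simp
  qed
  have "S \<in> null_sets lborel"
    unfolding S_def loop_path(3)[OF assms] side_def using segment_null_sets
    by (intro null_sets_UN') auto
  with N have "N \<union> S \<in> null_sets lborel" by auto
  have closed: "closed S"
    unfolding S_def using loop_path(1)[OF assms] by (intro closed_path_image)
  have T: "compact (T i)" for i
    unfolding T_def by (intro finite_imp_compact_convex_hull) auto
  have "mp_A vs = (LINT z | lborel. indicat_real (- S) z *\<^sub>R Re (winding_number (loop vs) z))"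
    by (simp add: mp_A_def set_lebesgue_integral_def S_def loop_path(3)[OF assms])
  also have "\<dots> = (LINT z | lborel. (\<Sum>i < length vs. sgn (k i) * indicat_real (T i) z))"
  proof (rule integral_cong_AE)
    have "continuous_on (- S) (\<lambda>z. Re (winding_number (loop vs) z))"
      unfolding S_def using loop_path[OF assms] 
      by (intro continuous_intros continuous_on_winding_number) auto
    then show "(\<lambda>z. indicat_real (- S) z *\<^sub>R Re (winding_number (loop vs) z)) \<in> borel_measurable lborel"
      using closed borel_measurable_continuous_on_indicator[of "- S"]
      unfolding measurable_lborel2 by (auto simp del: real_scaleR_def)
    show "(\<lambda>z. \<Sum>i < length vs. sgn (k i) * indicat_real (T i) z) \<in> borel_measurable lborel"
      using T by (intro borel_measurable_sum borel_measurable_times borel_measurable_indicator)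
        (auto intro: borel_closed compact_imp_closed)
    show "AE z in lborel. indicat_real (- S) z *\<^sub>R Re (winding_number (loop vs) z)
            = (\<Sum>i < length vs. sgn (k i) * indicat_real (T i) z)"
    proof (rule AE_I'[OF \<open>N \<union> S \<in> null_sets lborel\<close>], clarify)
      fix z assume "indicat_real (- S) z *\<^sub>R Re (winding_number (loop vs) z)
            \<noteq> (\<Sum>i < length vs. sgn (k i) * indicat_real (T i) z)" "z \<notin> S"
      then show "z \<in> N" using wn[of z] by (cases "z \<in> N") auto
    qed
  qed
  also have "\<dots> = (\<Sum>i < length vs. sgn (k i) * measure lborel (T i))"
  proof -
    have "integrable lborel (\<lambda>z. sgn (k i) * indicat_real (T i) z)" for i
      using T[of i] emeasure_compact_finite[OF T[of i]]
      by (intro integrable_mult_right integrable_real_indicator) (auto intro: borel_closed compact_imp_closed)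
    then show ?thesis using T
      by (subst Bochner_Integration.integral_sum) (auto intro!: sum.cong borel_closed compact_imp_closed)
  qed
  also have "\<dots> = (\<Sum>i < length vs. k i / 2)"
  proof (rule sum.cong[OF refl])
    fix i
    have "measure lborel (T i) = \<bar>k i\<bar> / 2"
      unfolding T_def k_def by (subst measure_complex_triangle) simp
    then show "sgn (k i) * measure lborel (T i) = k i / 2"
      by (simp add: sgn_if)
  qed
  also have "\<dots> = of_int (shoelace vs) / 2"
    by (simp add: k_def p_def shoelace_def cross_def pt_def sum_divide_distrib)
  finally show ?thesis .
qed

section \<open>The length sum modulo 2\<close>

text \<open>
  With \<open>g\<close> the greatest common divisor of the coordinate differences, the lattice points on the
  side are the \<open>g + 1\<close> points at multiples of the primitive vector \<open>(a, b)\<close>. That there are no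
  others follows from a Bezout identity \<open>u a + v b = 1\<close>: it turns the real parameter of a lattice
  point, measured in units of \<open>(a, b)\<close>, into an integer.
\<close>

lemma side_length_eq_gcd:
  assumes "cyc vs i \<noteq> cyc vs (i + 1)"
  shows "side_length vs i = gcd (fst (cyc vs (i + 1)) - fst (cyc vs i))
                                (snd (cyc vs (i + 1)) - snd (cyc vs i))"
proof -
  obtain x y where p: "cyc vs i = (x, y)" by fastforce
  obtain x' y' where q: "cyc vs (i + 1) = (x', y')" by fastforce
  define g where "g = gcd (x' - x) (y' - y)"
  have "g > 0" using assms p q by (auto simp: g_def)
  obtain a b where ab: "x' = x + g * a" "y' = y + g * b"
    using gcd_dvd1[of "x' - x" "y' - y"] gcd_dvd2[of "x' - x" "y' - y"]
    unfolding g_def[symmetric] dvd_def by (metis add_diff_cancel_left' diff_add_cancel add.commute)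
  obtain u v where "u * (x' - x) + v * (y' - y) = g"
    using bezout_int g_def by metis
  then have "g * (u * a + v * b) = g * 1" using ab by (simp add: algebra_simps)
  then have uv: "u * a + v * b = 1" using \<open>g > 0\<close> by (subst (asm) mult_cancel_left) simp
  let ?f = "\<lambda>k. (x + k * a, y + k * b)"
  have "{r. pt r \<in> side vs i} = ?f ` {0..g}"
  proof (intro equalityI subsetI)
    fix r assume "r \<in> {r. pt r \<in> side vs i}"
    then obtain t where t: "0 \<le> t" "t \<le> 1"
        "pt r = (1 - t) *\<^sub>R pt (x, y) + t *\<^sub>R pt (x', y')"
      by (auto simp: side_def p q[simplified] in_segment)
    then have r: "real_of_int (fst r - x) = (t * g) * a" "real_of_int (snd r - y) = (t * g) * b"
      by (auto simp: pt_def complex_eq_iff ab algebra_simps)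
    define k where "k = u * (fst r - x) + v * (snd r - y)"
    have "real_of_int k = (t * g) * of_int (u * a + v * b)"
      unfolding k_def of_int_add of_int_mult[of u] of_int_mult[of v] r by (simp add: algebra_simps)
    then have k: "real_of_int k = t * g" using uv by simp
    then have "fst r = x + k * a" "snd r = y + k * b"
      using r unfolding k[symmetric] of_int_mult[symmetric] of_int_eq_iff by simp_all
    moreover have "0 \<le> real_of_int k" "real_of_int k \<le> of_int g"
      unfolding k using t \<open>g > 0\<close> by (auto simp: mult_left_le_one_le)
    ultimately show "r \<in> ?f ` {0..g}"
      by (intro image_eqI[of _ _ k]) (auto simp: prod_eq_iff)
  next
    fix r assume "r \<in> ?f ` {0..g}"
    then obtain k where k: "r = ?f k" "0 \<le> k" "k \<le> g" by (elim imageE) (erule that; simp only: atLeastAtMost_iff)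
    have "pt r = (1 - of_int k / of_int g) *\<^sub>R pt (x, y) + (of_int k / of_int g) *\<^sub>R pt (x', y')"
      using \<open>g > 0\<close> by (simp add: k pt_def ab complex_eq_iff field_simps)
    then have "pt r \<in> closed_segment (pt (x, y)) (pt (x', y'))"
      using k \<open>g > 0\<close> by (auto simp: in_segment intro!: exI[of _ "of_int k / of_int g"])
    then show "r \<in> {r. pt r \<in> side vs i}" using p q by (simp add: side_def)
  qed
  moreover have "inj_on ?f {0..g}"
  proof (rule inj_onI)
    fix k l assume "?f k = ?f l"
    then have "(u * a + v * b) * k = (u * a + v * b) * l" by (auto simp: algebra_simps)
    then show "k = l" using uv by simp
  qed
  ultimately have "card {r. pt r \<in> side vs i} = nat (g + 1)"
    by (simp add: card_image)
  then show ?thesis using \<open>g > 0\<close> p q by (simp add: side_length_def g_def)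
qed

lemma multi_polygonD:
  assumes "lattice_multi_polygon vs es"
  shows "vs \<noteq> []" "length es = length vs" "cyc es i = 1 \<or> cyc es i = -1"
    "cyc vs i \<noteq> cyc vs (i + 1)"
proof -
  show 1: "vs \<noteq> []" "length es = length vs"
    using assms by (auto simp: lattice_multi_polygon_def)
  have "cyc es i \<in> set es" using 1 by (auto simp: cyc_def intro!: nth_mem)
  then show "cyc es i = 1 \<or> cyc es i = -1"
    using assms by (auto simp: lattice_multi_polygon_def)
  have "i mod length vs < length vs" using 1 by simp
  then have "cyc vs (i mod length vs) \<noteq> cyc vs (i mod length vs + 1)"
    using assms by (auto simp: lattice_multi_polygon_def simp del: mod_less_divisor)
  then show "cyc vs i \<noteq> cyc vs (i + 1)" by (simp add: cyc_def mod_Suc_eq)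
qed

text \<open>
  Signs do not matter modulo 2, and \<open>gcd x y\<close> is even iff \<open>x\<close> and \<open>y\<close> both are, that is,
  \<open>gcd x y \<equiv> x + y + x y\<close>. For a side from \<open>(x, y)\<close> to \<open>(x', y')\<close> this gives
  \<open>gcd (x' - x) (y' - y) \<equiv> (x y' - y x') + h (x', y') - h (x, y)\<close> modulo 2 with
  \<open>h (x, y) = x + y + x y\<close>, and the differences of \<open>h\<close> telescope around the loop.
\<close>

lemma mp_B_shoelace_parity:
  assumes mp: "lattice_multi_polygon vs es"
  shows "even (mp_B vs es - shoelace vs)"
proof -
  define h :: "int \<times> int \<Rightarrow> int" where "h v = fst v + snd v + fst v * snd v" for v
  define X Y where "X i = fst (cyc vs i)" and "Y i = snd (cyc vs i)" for i
  define s where "s i = X i * Y (i + 1) - Y i * X (i + 1)" for i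
  have "even (cyc es i * side_length vs i - s i - (h (cyc vs (i + 1)) - h (cyc vs i)))" for i
  proof -
    have "even (side_length vs i) \<longleftrightarrow> even (X (i + 1) - X i) \<and> even (Y (i + 1) - Y i)"
      using multi_polygonD(4)[OF mp, of i] side_length_eq_gcd[of vs i]
      by (simp add: X_def Y_def)
    then show ?thesis using multi_polygonD(3)[OF mp, of i]
      by (auto simp: h_def s_def X_def[symmetric] Y_def[symmetric] simp del: One_nat_def add_Suc_right)
  qed
  then have "even (\<Sum>i < length vs.
      cyc es i * side_length vs i - s i - (h (cyc vs (i + 1)) - h (cyc vs i)))"
    by (intro dvd_sum) auto
  also have "(\<Sum>i < length vs.
      cyc es i * side_length vs i - s i - (h (cyc vs (i + 1)) - h (cyc vs i)))
      = mp_B vs es - shoelace vs"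
    using sum_cyc_shift[OF multi_polygonD(1)[OF mp], of h]
    by (simp add: sum_subtractf mp_B_def shoelace_def cross_def s_def X_def Y_def)
  finally show ?thesis .
qed

section \<open>The rotation number\<close>

lemma side_normal_nonzero:
  assumes "lattice_multi_polygon vs es"
  shows "side_normal vs es i \<noteq> 0"
  using multi_polygonD(3,4)[OF assms, of i]
  by (auto simp: side_normal_def pt_def complex_eq_iff prod_eq_iff)

text \<open>
  The quotients of consecutive normals multiply to 1 around the loop, so their arguments add up to
  a multiple of the full angle.
\<close>

lemma mp_C_in_Ints:
  assumes mp: "lattice_multi_polygon vs es"
  shows "mp_C vs es \<in> \<int>"
proof -
  let ?n = "side_normal vs es" and ?d = "length vs"
  define t where "t i = Arg (?n (i + 1) / ?n i)" for i
  have nz: "sgn (?n i) \<noteq> 0" for i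
    using side_normal_nonzero[OF mp] by (simp add: sgn_zero_iff)
  have "cis (t i) = sgn (?n (Suc i)) / sgn (?n i)" for i
    using side_normal_nonzero[OF mp] by (simp add: t_def cis_Arg sgn_divide)
  then have "exp (\<i> * of_real (\<Sum>i < ?d. t i)) = (\<Prod>i < ?d. sgn (?n (Suc i)) / sgn (?n i))"
    by (simp add: sum_distrib_left exp_sum cis_conv_exp)
  also have "\<dots> = sgn (?n ?d) / sgn (?n 0)"
    using nz by (intro prod_lessThan_telescope) auto
  also have "?n ?d = ?n 0"
    using multi_polygonD(2)[OF mp] cyc_add_length[of vs 0] cyc_add_length[of vs 1] cyc_add_length[of es 0]
    by (simp add: side_normal_def)
  finally have "exp (\<i> * of_real (\<Sum>i < ?d. t i)) = 1" using nz by simp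
  then obtain k :: int where "(\<Sum>i < ?d. t i) = of_int (2 * k) * pi"
    by (auto simp: exp_eq_1)
  then show ?thesis by (simp add: mp_C_def t_def)
qed

section \<open>Turns in integer coordinates\<close>

definition edge :: "(int \<times> int) list \<Rightarrow> nat \<Rightarrow> int \<times> int" where
  "edge vs i = cyc vs (i + 1) - cyc vs i"

definition dot :: "int \<times> int \<Rightarrow> int \<times> int \<Rightarrow> int" where
  "dot u w = fst u * fst w + snd u * snd w"

text \<open>
  Multiplying the quotient of two normals by a positive real number does not change its argument,
  and the common rotation by 90 degrees cancels; what remains are the dot and cross products of the
  two edges. This makes rotation numbers of explicit lattice multi-polygons computable.
\<close>

lemma Arg_turn:
  fixes i :: nat
  assumes "lattice_multi_polygon vs es"
  defines "s \<equiv> cyc es i * cyc es (i + 1)"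
  shows "Arg (side_normal vs es (i + 1) / side_normal vs es i)
    = Arg (Complex (of_int (s * dot (edge vs i) (edge vs (i + 1))))
                   (of_int (s * cross (edge vs i) (edge vs (i + 1)))))"
proof -
  define n where "n = side_normal vs es"
  have "n (i + 1) / n i = (n (i + 1) * cnj (n i)) / of_real (norm (n i) ^ 2)"
    using complex_div_cnj[of "n (i + 1)" "n i"] by simp
  also have "Arg \<dots> = Arg (n (i + 1) * cnj (n i))"
    using side_normal_nonzero[OF assms(1)] by (intro Arg_divide_of_real) (simp add: n_def)
  also have "n (i + 1) * cnj (n i) = Complex (of_int (s * dot (edge vs i) (edge vs (i + 1))))
                   (of_int (s * cross (edge vs i) (edge vs (i + 1))))"
    by (simp add: complex_eq_iff n_def side_normal_def pt_def s_def dot_def cross_def edge_def algebra_simps)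
  finally show ?thesis unfolding n_def .
qed

lemma mp_C_eq_turns:
  assumes "lattice_multi_polygon vs es"
  shows "mp_C vs es = (\<Sum>i < length vs. Arg (Complex
      (of_int (cyc es i * cyc es (i + 1) * dot (edge vs i) (edge vs (i + 1))))
      (of_int (cyc es i * cyc es (i + 1) * cross (edge vs i) (edge vs (i + 1)))))) / (2 * pi)"
  unfolding mp_C_def using Arg_turn[OF assms] by simp

lemma Arg_diagonal: "Arg (Complex (-1) 1) = 3 * pi / 4" "Arg (Complex (-1) (-1)) = - (3 * pi / 4)"
proof -
  have c: "cos (3 * pi / 4) = - (sqrt 2 / 2)" "sin (3 * pi / 4) = sqrt 2 / 2"
    using cos_add[of "pi / 2" "pi / 4"] sin_add[of "pi / 2" "pi / 4"]
    by (simp_all add: cos_45 sin_45 algebra_simps)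
  show 1: "Arg (Complex (-1) 1) = 3 * pi / 4"
    by (intro Arg_unique'[of "sqrt 2"]) (simp_all add: complex_eq_iff c)
  have "Complex (-1) (-1) = cnj (Complex (-1) 1)" by (simp add: complex_eq_iff)
  then show "Arg (Complex (-1) (-1)) = - (3 * pi / 4)"
    using 1 by (simp add: Arg_cnj complex_is_Real_iff)
qed

lemma Arg_axis: "Arg (Complex 1 0) = 0" "Arg (Complex 0 1) = pi / 2" "Arg (Complex 0 (-1)) = - (pi / 2)"
proof -
  have "- (pi / 2) \<le> pi" using pi_gt_zero by linarith
  then show "Arg (Complex 1 0) = 0" "Arg (Complex 0 1) = pi / 2" "Arg (Complex 0 (-1)) = - (pi / 2)"
    by (intro Arg_unique'[of 1]; simp add: complex_eq_iff)+
qed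

section \<open>Gluing multi-polygons along a common first side\<close>

text \<open>
  Two multi-polygons with the same first side, with the same sign, can be run through one after the
  other. The defining conditions and all three invariants are local: they involve at most three
  consecutive vertices and two consecutive signs, so it is enough that the lists agree on their first
  two vertices and on their first sign.
\<close>

lemma append_common_first_side:
  assumes mp: "lattice_multi_polygon vs es" "lattice_multi_polygon ws fs"
    and len: "2 \<le> length vs" "2 \<le> length ws"
    and eq: "take 2 vs = take 2 ws" "take 1 es = take 1 fs"
  shows "lattice_multi_polygon (vs @ ws) (es @ fs)"
    "shoelace (vs @ ws) = shoelace vs + shoelace ws"
    "mp_B (vs @ ws) (es @ fs) = mp_B vs es + mp_B ws fs"
    "mp_C (vs @ ws) (es @ fs) = mp_C vs es + mp_C ws fs"
proof -
  have len': "length es = length vs" "length fs = length ws"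
    using multi_polygonD[OF mp(1)] multi_polygonD[OF mp(2)] by auto
  have v1: "cyc (vs @ ws) (i + k) = cyc vs (i + k)" if "i < length vs" "k \<le> 2" for i k
    using cyc_append(1)[OF eq(1)] that len by auto
  have v2: "cyc (vs @ ws) (length vs + j + k) = cyc ws (j + k)" if "j < length ws" "k \<le> 2" for j k
    using cyc_append(2)[OF eq(1)] that len by auto
  have e1: "cyc (es @ fs) (i + k) = cyc es (i + k)" if "i < length vs" "k \<le> 1" for i k
    using cyc_append(1)[OF eq(2)] that len len' by auto
  have e2: "cyc (es @ fs) (length vs + j + k) = cyc fs (j + k)" if "j < length ws" "k \<le> 1" for j k
    using cyc_append(2)[OF eq(2), of k j] that len len' by auto
  note c = v1[of _ 0] v1[of _ 1] v1[of _ 2] v2[of _ 0] v2[of _ 1] v2[of _ 2]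
    e1[of _ 0] e1[of _ 1] e2[of _ 0] e2[of _ 1]
  note c = c[simplified]
  have s: "side (vs @ ws) i = side vs i" if "i < length vs" for i
    using that by (simp add: side_def c)
  have s': "side (vs @ ws) (length vs + j) = side ws j" if "j < length ws" for j
    using that by (simp add: side_def c)
  show "lattice_multi_polygon (vs @ ws) (es @ fs)"
    using mp unfolding lattice_multi_polygon_def length_append all_less_add
    by (simp add: c)
  show "shoelace (vs @ ws) = shoelace vs + shoelace ws"
    by (simp add: shoelace_def sum_lessThan_add c)
  show "mp_B (vs @ ws) (es @ fs) = mp_B vs es + mp_B ws fs"
    by (simp add: mp_B_def sum_lessThan_add side_length_def s s' c)
  show "mp_C (vs @ ws) (es @ fs) = mp_C vs es + mp_C ws fs"
    by (simp add: mp_C_def sum_lessThan_add side_normal_def c add_divide_distrib)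
qed

text \<open>
  Fixing one first side and its sign makes the set of attained triples closed under addition. The
  area is doubled to stay among the integers.
\<close>

definition anchored :: "int \<Rightarrow> int \<Rightarrow> real \<Rightarrow> bool" where
  "anchored m n c \<longleftrightarrow> (\<exists>vs es. lattice_multi_polygon vs es \<and>
     take 2 vs = [(0, 0), (1, 0)] \<and> take 1 es = [1] \<and>
     shoelace vs = m \<and> mp_B vs es = n \<and> mp_C vs es = c)"

lemma anchored_add:
  assumes "anchored m n c" "anchored m' n' c'"
  shows "anchored (m + m') (n + n') (c + c')"
proof -
  obtain vs es where v: "lattice_multi_polygon vs es" "take 2 vs = [(0, 0), (1, 0)]"
      "take 1 es = [1]" "shoelace vs = m" "mp_B vs es = n" "mp_C vs es = c"
    using assms(1) unfolding anchored_def by blast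
  obtain ws fs where w: "lattice_multi_polygon ws fs" "take 2 ws = [(0, 0), (1, 0)]"
      "take 1 fs = [1]" "shoelace ws = m'" "mp_B ws fs = n'" "mp_C ws fs = c'"
    using assms(2) unfolding anchored_def by blast
  have len: "2 \<le> length vs" "2 \<le> length ws" "1 \<le> length es"
    using v(2) w(2) v(3) by (auto dest!: arg_cong[where f = length] simp: min_def split: if_splits)
  show ?thesis
    unfolding anchored_def
    using append_common_first_side[OF v(1) w(1) len(1,2)] v w len
    by (intro exI[of _ "vs @ ws"] exI[of _ "es @ fs"]) simp
qed

lemma anchored_multiple:
  assumes "anchored m n c" "anchored (- m) (- n) (- c)"
  shows "anchored (k * m) (k * n) (of_int k * c)"
proof -
  have zero: "anchored 0 0 0" using anchored_add[OF assms] by simp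
  have nat: "anchored (int j * m) (int j * n) (of_nat j * c)" if "anchored m n c" for j m n c
  proof (induction j)
    case (Suc j)
    show ?case using anchored_add[OF that Suc] by (simp add: algebra_simps)
  qed (simp add: zero)
  show ?thesis
  proof (cases "k \<ge> 0")
    case True
    then show ?thesis using nat[OF assms(1), of "nat k"] by simp
  next
    case False
    then show ?thesis using nat[OF assms(2), of "nat (- k)"] by simp
  qed
qed

section \<open>Building blocks\<close>

lemma dot_self_nonneg: "dot u u \<ge> 0"
  by (simp add: dot_def)

lemma closed_segment_dot_nonneg:
  assumes "pt q \<in> closed_segment (pt p) (pt r)"
  shows "dot (q - p) (r - q) \<ge> 0"
proof -
  obtain t where t: "0 \<le> t" "t \<le> 1" "pt q = (1 - t) *\<^sub>R pt p + t *\<^sub>R pt r"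
    using assms by (auto simp: in_segment)
  then have e: "real_of_int (fst (q - p)) = t * of_int (fst (r - p))"
      "real_of_int (snd (q - p)) = t * of_int (snd (r - p))"
      "real_of_int (fst (r - q)) = (1 - t) * of_int (fst (r - p))"
      "real_of_int (snd (r - q)) = (1 - t) * of_int (snd (r - p))"
    by (simp_all add: pt_def complex_eq_iff algebra_simps)
  have "real_of_int (dot (q - p) (r - q))
      = (t * (1 - t)) * (of_int (fst (r - p)) ^ 2 + of_int (snd (r - p)) ^ 2)"
    unfolding dot_def of_int_add of_int_mult e by (simp add: algebra_simps power2_eq_square)
  also have "\<dots> \<ge> 0" using t by simp
  finally show ?thesis by simp
qed

lemma collinear_pt_iff: "collinear {pt p, pt q, pt r} \<longleftrightarrow> cross (q - p) (r - q) = 0"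
proof -
  have "collinear {pt p, pt q, pt r} \<longleftrightarrow> collinear {0, pt p - pt q, pt r - pt q}"
    by (rule collinear_3) (simp add: NO_MATCH_def)
  also have "\<dots> \<longleftrightarrow> real_of_int (cross (q - p) (r - q)) = 0"
    by (auto simp: collinear_iff_Reals complex_is_Real_iff Im_divide pt_def cross_def algebra_simps)
  finally show ?thesis by simp
qed

text \<open>
  For nonzero parallel edges the sign of their dot product tells whether the path goes on straight or
  turns back. So the sign conditions for going straight on and for turning back both say that the dot product of
  the two normals is positive.
\<close>

lemma multi_polygonI:
  assumes "vs \<noteq> []" "length es = length vs" "set es \<subseteq> {1, -1}"
    and "\<forall>i < length vs. edge vs i \<noteq> 0"
    and straight: "\<forall>i < length vs. cross (edge vs i) (edge vs (i + 1)) = 0 \<longrightarrow>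
           cyc es i * cyc es (i + 1) * dot (edge vs i) (edge vs (i + 1)) > 0"
  shows "lattice_multi_polygon vs es"
  unfolding lattice_multi_polygon_def
proof (intro conjI allI impI)
  fix i assume i: "i < length vs"
  assume "collinear {vertex vs i, vertex vs (i + 1), vertex vs (i + 2)}"
  then have "cross (edge vs i) (edge vs (i + 1)) = 0"
    by (simp add: collinear_pt_iff edge_def)
  then have pos: "cyc es i * cyc es (i + 1) * dot (edge vs i) (edge vs (i + 1)) > 0"
    using straight i by blast
  have "cyc es j \<in> set es" for j using assms(1,2) by (auto simp: cyc_def intro!: nth_mem)
  then have es: "cyc es j = 1 \<or> cyc es j = -1" for j using assms(3) by blast
  show "cyc es i = cyc es (i + 1)"
    if "vertex vs (i + 1) \<in> closed_segment (vertex vs i) (vertex vs (i + 2))"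
    using closed_segment_dot_nonneg[OF that] pos es[of i] es[of "i + 1"]
    by (auto simp: edge_def)
  show "cyc es i \<noteq> cyc es (i + 1)"
    if "vertex vs i \<in> closed_segment (vertex vs (i + 1)) (vertex vs (i + 2)) \<or>
           vertex vs (i + 2) \<in> closed_segment (vertex vs i) (vertex vs (i + 1))"
    using that
  proof
    assume "vertex vs i \<in> closed_segment (vertex vs (i + 1)) (vertex vs (i + 2))"
    from closed_segment_dot_nonneg[OF this] have "dot (edge vs i) (edge vs (i + 1)) \<le> 0"
      using dot_self_nonneg[of "edge vs i"] by (simp add: edge_def dot_def algebra_simps)
    then show ?thesis using pos es[of i] es[of "i + 1"] by auto
  next
    assume "vertex vs (i + 2) \<in> closed_segment (vertex vs i) (vertex vs (i + 1))"
    from closed_segment_dot_nonneg[OF this] have "dot (edge vs i) (edge vs (i + 1)) \<le> 0"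
      using dot_self_nonneg[of "edge vs (i + 1)"] by (simp add: edge_def dot_def algebra_simps)
    then show ?thesis using pos es[of i] es[of "i + 1"] by auto
  qed
qed (use assms(1-4) in \<open>auto simp: edge_def\<close>)

lemma mp_B_eq_gcd:
  assumes "lattice_multi_polygon vs es"
  shows "mp_B vs es = (\<Sum>i < length vs. cyc es i * gcd (fst (edge vs i)) (snd (edge vs i)))"
  unfolding mp_B_def edge_def
  using side_length_eq_gcd[OF multi_polygonD(4)[OF assms]] by simp

lemmas explicit_polygon_simps = edge_def cyc_def dot_def cross_def lessThan_Suc All_less_Suc
  zero_prod_def Arg_axis Arg_diagonal

text \<open>
  The only building block that changes the area, by one half; its length sum \<open>3\<close> is odd, as the
  parity relation requires. Reflecting it reverses both the area and the rotation number.
\<close>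

lemma anchored_triangle:
  assumes "\<sigma> \<in> {1, -1}"
  shows "anchored \<sigma> 3 (of_int \<sigma>)"
proof -
  let ?vs = "[(0, 0), (1, 0), (0, \<sigma>)]" and ?es = "[1, 1, 1 :: int]"
  have mp: "lattice_multi_polygon ?vs ?es"
    by (rule multi_polygonI) (use assms in \<open>auto simp: explicit_polygon_simps\<close>)
  have "shoelace ?vs = \<sigma>" using assms by (auto simp: shoelace_def explicit_polygon_simps)
  moreover have "mp_B ?vs ?es = 3"
    unfolding mp_B_eq_gcd[OF mp] using assms by (auto simp: explicit_polygon_simps)
  moreover have "mp_C ?vs ?es = of_int \<sigma>"
    unfolding mp_C_eq_turns[OF mp] using assms by (auto simp: explicit_polygon_simps)
  ultimately show ?thesis unfolding anchored_def using mp
    by (intro exI[of _ ?vs] exI[of _ ?es]) simp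
qed

text \<open>
  A zigzag \<open>p\<^sub>0 p\<^sub>1 p\<^sub>2 p\<^sub>3\<close> walked forth and back encloses no area. At its ends the path turns back,
  which forces opposite signs, so the outer sides cancel in the length sum. At the two corners the
  signs are free; the middle side gets the sign \<open>\<sigma>\<close> in both directions and contributes \<open>2 \<sigma>\<close>.
  The quarter turns at the corners add up to \<open>2 \<sigma> (1 - \<tau>)\<close>, where \<open>\<tau>\<close> is the sign of
  \<open>p\<^sub>2 p\<^sub>3\<close>: for \<open>\<tau> = 1\<close> the rotation number is \<open>0\<close>, for \<open>\<tau> = -1\<close> it is \<open>\<sigma>\<close>.
\<close>

lemma anchored_zigzag:
  assumes "\<sigma> \<in> {1, -1}" "\<tau> \<in> {1, -1}"
  shows "anchored 0 (2 * \<sigma>) (of_int (\<sigma> * (1 - \<tau>)) / 2)"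
proof -
  let ?vs = "[(0, 0), (1, 0), (1, 1), (2, 1), (1, 1), (1, 0)]"
    and ?es = "[1, \<sigma>, \<tau>, - \<tau>, \<sigma>, - 1 :: int]"
  have mp: "lattice_multi_polygon ?vs ?es"
    by (rule multi_polygonI) (use assms in \<open>auto simp: explicit_polygon_simps\<close>)
  have "shoelace ?vs = 0" by (simp add: shoelace_def explicit_polygon_simps)
  moreover have "mp_B ?vs ?es = 2 * \<sigma>"
    unfolding mp_B_eq_gcd[OF mp] using assms by (auto simp: explicit_polygon_simps)
  moreover have "mp_C ?vs ?es = of_int (\<sigma> * (1 - \<tau>)) / 2"
    unfolding mp_C_eq_turns[OF mp] using assms by (auto simp: explicit_polygon_simps)
  ultimately show ?thesis unfolding anchored_def using mp
    by (intro exI[of _ ?vs] exI[of _ ?es]) simp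
qed

section \<open>The classification\<close>

text \<open>
  The zigzags give \<open>(0, \<plusminus>2, 0)\<close> and \<open>\<plusminus>(0, 2, 1)\<close>, hence all of \<open>{0} \<times> 2\<int> \<times> \<int>\<close>. Together with the
  triangles, which have the odd length sum \<open>3\<close>, they generate all triples with \<open>m \<equiv> n\<close> modulo 2.
\<close>

lemma anchored_all:
  assumes "even (n - m)"
  shows "anchored m n (of_int l)"
proof -
  have b: "anchored 0 2 0" "anchored 0 (- 2) 0" "anchored 0 2 1" "anchored 0 (- 2) (- 1)"
    using anchored_zigzag[of 1 1] anchored_zigzag[of "-1" 1]
      anchored_zigzag[of 1 "-1"] anchored_zigzag[of "-1" "-1"] by simp_all
  have B: "anchored 0 (k * 2) 0" for k
    using anchored_multiple[of 0 2 0 k] b by simp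
  \<comment> \<open>A full turn alone is \<open>(0, 2, 1) + (0, -2, 0)\<close>.\<close>
  have C: "anchored 0 0 (of_int k)" for k
    using anchored_multiple[of 0 0 1 k] anchored_add[OF b(2,3)] anchored_add[OF b(1,4)] by simp
  have "anchored (- 1) (- 3) (- 1)"
    using anchored_add[OF anchored_triangle[of "- 1"] B[of "- 3"]] by simp
  then have A: "anchored k (k * 3) (of_int k)" for k
    using anchored_multiple[of 1 3 1 k] anchored_triangle[of 1] by simp
  from assms have "even (n - m * 3)" by simp
  then obtain k where "n = m * 3 + k * 2"
    by (elim evenE) (metis add_diff_cancel_left' diff_add_cancel mult.commute add.commute)
  then show ?thesis
    using anchored_add[OF anchored_add[OF A[of m] B[of k]] C[of "l - m"]] by simp
qed

theorem theorem4p1: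
  fixes a b c :: real
  shows "(\<exists>vs es. lattice_multi_polygon vs es \<and>
            (a, b, c) = (mp_A vs, of_int (mp_B vs es) / 2, mp_C vs es)) \<longleftrightarrow>
         (a, b, c) \<in> triples"
proof
  assume "\<exists>vs es. lattice_multi_polygon vs es \<and>
            (a, b, c) = (mp_A vs, of_int (mp_B vs es) / 2, mp_C vs es)"
  then obtain vs es where mp: "lattice_multi_polygon vs es"
    and abc: "a = mp_A vs" "b = of_int (mp_B vs es) / 2" "c = mp_C vs es" by auto
  have a: "a = of_int (shoelace vs) / 2"
    using mp_A_eq_shoelace multi_polygonD(1)[OF mp] abc by simp
  obtain k where "mp_B vs es - shoelace vs = 2 * k"
    using mp_B_shoelace_parity[OF mp] by (elim evenE)
  then have "mp_B vs es = 2 * k + shoelace vs" by simp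
  then have "a + b = of_int (shoelace vs + k)"
    by (simp add: a abc add_divide_distrib)
  then have "a + b \<in> \<int>" by (metis Ints_of_int)
  then show "(a, b, c) \<in> triples"
    unfolding triples_def half_ints_def using a abc(2,3) mp_C_in_Ints[OF mp] by blast
next
  assume "(a, b, c) \<in> triples"
  then obtain m n l k :: int where abc: "a = of_int m / 2" "b = of_int n / 2" "c = of_int l"
      "a + b = of_int k"
    unfolding triples_def half_ints_def by (auto elim!: Ints_cases)
  then have "real_of_int (m + n) = of_int (2 * k)" by simp
  then have "m + n = 2 * k" unfolding of_int_eq_iff .
  then have "n - m = 2 * (k - m)" by simp
  then have "even (n - m)" by (metis dvd_triv_left)
  from anchored_all[OF this, of l] obtain vs es where
    "lattice_multi_polygon vs es" "shoelace vs = m" "mp_B vs es = n" "mp_C vs es = of_int l"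
    unfolding anchored_def by blast
  then show "\<exists>vs es. lattice_multi_polygon vs es \<and>
            (a, b, c) = (mp_A vs, of_int (mp_B vs es) / 2, mp_C vs es)"
    using abc mp_A_eq_shoelace[of vs] multi_polygonD(1)[of vs es]
    by (intro exI[of _ vs] exI[of _ es]) simp
qed

end
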